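(* There exists an absolute constant $C>0$ such that for all integers $k\ge 2$ and $d\ge1$, the price of explainability $\rho_{k,d}$ of the $k$-means problem in $\mathbb{R}^d$ satisfies $\rho_{k,d}\le C\,d\,k\log k$.
   Context: An instance of the $k$-means problem is a finite set $X\subset\mathbb{R}^d$ of $n\ge k$ points, with $k\ge2$. A $k$-clustering is a partition $\mathcal{C}=(C_1,\dots,C_k)$ of $X$ into $k$ groups together with a representative $\mu(C_i)\in\mathbb{R}^d$ for each group; its cost is $cost(\mathcal{C})=\sum_{i=1}^k\sum_{x\in C_i}\|x-\mu(C_i)\|_2^2$. A standard decision tree is a binary tree in which each internal node $v$ is associated with a cut $(i_v,\theta_v)$, $i_v\in\{1,\dots,d\}$, $\theta_v\in\mathbb{R}$; the points reaching $v$ with $i_v$-th coordinate $\le\theta_v$ go to one child and those with $i_v$-th coordinate $>\theta_v$ go to the other. A $k$-clustering is explainable if its partition is the one induced on $X$ by the leaves of a standard decision tree with $k$ leaves (representatives may be arbitrary points of $\mathbb{R}^d$). $OPT_{unr}(X)$ is the minimum cost over all $k$-clusterings of $X$, $OPT_{exp}(X)$ is the minimum cost over all explainable $k$-clusterings of $X$. The price of explainability is $\rho_{k,d}=\sup_X OPT_{exp}(X)/OPT_{unr}(X)$, over all instances $X\subset\mathbb{R}^d$ with $OPT_{unr}(X)>0$. *)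

theory Defs
  imports "HOL-Analysis.Analysis" "HOL-Library.Tree"
begin

text \<open>
  The dimension is quantified inside the theorem, so it cannot be a type: points of
  \<open>d\<close>-dimensional space are the functions on \<open>{1..d}\<close>, extended by \<^term>\<open>undefined\<close>
  outside so that distinct functions are distinct points.
\<close>

definition Rn :: "nat \<Rightarrow> (nat \<Rightarrow> real) set" where
  "Rn d = {1..d} \<rightarrow>\<^sub>E UNIV"

definition dist2 :: "nat \<Rightarrow> (nat \<Rightarrow> real) \<Rightarrow> (nat \<Rightarrow> real) \<Rightarrow> real" where
  "dist2 d x y = L2_set (\<lambda>i. x i - y i) {1..d}"

definition kmeans_instance :: "nat \<Rightarrow> nat \<Rightarrow> (nat \<Rightarrow> real) set \<Rightarrow> bool" where
  "kmeans_instance k d X \<longleftrightarrow> finite X \<and> X \<subseteq> Rn d \<and> k \<le> card X"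

text \<open>
  A clustering is a partition \<open>P\<close> together with a representative \<open>\<mu> C\<close> for each group
  \<open>C \<in> P\<close>. Groups are nonempty and pairwise distinct by \<^const>\<open>partition_on\<close>, so
  indexing representatives by the groups themselves loses nothing.
\<close>

definition clustering ::
  "nat \<Rightarrow> nat \<Rightarrow> (nat \<Rightarrow> real) set \<Rightarrow>
    (nat \<Rightarrow> real) set set \<Rightarrow> ((nat \<Rightarrow> real) set \<Rightarrow> (nat \<Rightarrow> real)) \<Rightarrow> bool" where
  "clustering k d X P \<mu> \<longleftrightarrow> partition_on X P \<and> card P = k \<and> \<mu> ` P \<subseteq> Rn d"

definition cost ::
  "nat \<Rightarrow> (nat \<Rightarrow> real) set set \<Rightarrow> ((nat \<Rightarrow> real) set \<Rightarrow> (nat \<Rightarrow> real)) \<Rightarrow> real" where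
  "cost d P \<mu> = (\<Sum>C\<in>P. \<Sum>x\<in>C. (dist2 d x (\<mu> C))\<^sup>2)"

text \<open>
  Internal nodes carry the cut \<open>(i, \<theta>)\<close>; the leaves of the decision tree are the
  occurrences of \<^const>\<open>Leaf\<close>, whose number is \<^const>\<open>size1\<close>.
\<close>

type_synonym decision_tree = "(nat \<times> real) tree"

definition valid_tree :: "nat \<Rightarrow> decision_tree \<Rightarrow> bool" where
  "valid_tree d T \<longleftrightarrow> (\<forall>(i, \<theta>) \<in> set_tree T. i \<in> {1..d})"

fun leaf_cells :: "decision_tree \<Rightarrow> (nat \<Rightarrow> real) set \<Rightarrow> (nat \<Rightarrow> real) set set" where
  "leaf_cells Leaf X = {X}"
| "leaf_cells (Node l (i, \<theta>) r) X =
     leaf_cells l {x \<in> X. x i \<le> \<theta>} \<union> leaf_cells r {x \<in> X. x i > \<theta>}"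

definition explainable :: "nat \<Rightarrow> nat \<Rightarrow> (nat \<Rightarrow> real) set \<Rightarrow> (nat \<Rightarrow> real) set set \<Rightarrow> bool" where
  "explainable k d X P \<longleftrightarrow> (\<exists>T. valid_tree d T \<and> size1 T = k \<and> P = leaf_cells T X)"

text \<open>
  For \<^prop>\<open>kmeans_instance k d X\<close> both infima below range over nonempty sets of nonnegative
  reals and are attained: there are finitely many partitions, and for each of them the
  centroids are optimal representatives.
\<close>

definition OPT_unr :: "nat \<Rightarrow> nat \<Rightarrow> (nat \<Rightarrow> real) set \<Rightarrow> real" where
  "OPT_unr k d X = Inf {cost d P \<mu> | P \<mu>. clustering k d X P \<mu>}"

definition OPT_exp :: "nat \<Rightarrow> nat \<Rightarrow> (nat \<Rightarrow> real) set \<Rightarrow> real" where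
  "OPT_exp k d X = Inf {cost d P \<mu> | P \<mu>. clustering k d X P \<mu> \<and> explainable k d X P}"

text \<open>The supremum is taken in the extended reals, as its finiteness is not known a priori.\<close>

definition price_of_explainability :: "nat \<Rightarrow> nat \<Rightarrow> ereal" where
  "price_of_explainability k d =
     (SUP X \<in> {X. kmeans_instance k d X \<and> OPT_unr k d X > 0}.
        ereal (OPT_exp k d X / OPT_unr k d X))"

end

theory Submission
  imports Defs
begin

text \<open>
  Starting from the centers of an arbitrary clustering, the tree is grown by induction on the set
  \<open>S\<close> of centers in the current cell: cut the coordinate in which \<open>S\<close> is widest, of width \<open>L\<close>. A point
  separated from its center by the cut is sent to another center of \<open>S\<close>, which costs at most
  \<open>2 * d * L\<^sup>2\<close> besides twice its old cost. The cut can be chosen so that the number \<open>F\<close> of separated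
  points satisfies \<open>F * L\<^sup>2 \<le> O(log k) * s * W\<close>, where \<open>s\<close> is the number of centers on the
  smaller side and \<open>W\<close> is the cost of the cell. The potential \<open>O(d * log k) * card S * W\<close> pays for
  this, since both children have at least \<open>s\<close> centers fewer and their costs \<open>W\<close> add up to at most
  the old one. Finally empty cells are dropped and cells are refined to reach exactly \<open>k\<close> groups.
\<close>

section \<open>Elementary inequalities for distances, sums and harmonic numbers\<close>

lemma dist2_squared: "(dist2 d x y)\<^sup>2 = (\<Sum>i=1..d. (x i - y i)\<^sup>2)"
  unfolding dist2_def L2_set_def by (simp add: sum_nonneg)

lemma dist2_squared_triangle:
  "(dist2 d x z)\<^sup>2 \<le> 2 * (dist2 d x y)\<^sup>2 + 2 * (dist2 d y z)\<^sup>2"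
proof -
  have "(x i - z i)\<^sup>2 \<le> 2 * (x i - y i)\<^sup>2 + 2 * (y i - z i)\<^sup>2" for i
    using zero_le_power2[of "(x i - y i) - (y i - z i)"]
    by (simp add: power2_eq_square algebra_simps)
  then have "(\<Sum>i=1..d. (x i - z i)\<^sup>2)
      \<le> (\<Sum>i=1..d. 2 * (x i - y i)\<^sup>2 + 2 * (y i - z i)\<^sup>2)"
    by (intro sum_mono)
  then show ?thesis
    by (simp add: dist2_squared sum.distrib sum_distrib_left)
qed

lemma Rn_distinct_coordinate:
  assumes "x \<in> Rn d" "y \<in> Rn d" "x \<noteq> y"
  obtains i where "i \<in> {1..d}" "x i \<noteq> y i"
  using assms unfolding Rn_def by (metis PiE_ext)

text \<open>The inequality \<open>ln t \<le> t - 1\<close> at \<open>t = n / (n + 1)\<close> shows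
  that each new term \<open>1 / (n + 1)\<close> is at most \<open>ln (n + 1) - ln n\<close>, and
  these differences telescope.\<close>

lemma harm_le_one_plus_ln:
  assumes "n \<ge> 1"
  shows "harm n \<le> 1 + ln (real n)"
  using assms
proof (induction n rule: dec_induct)
  case base
  then show ?case by (simp add: harm_def)
next
  case (step n)
  have "ln (real n / real (Suc n)) \<le> real n / real (Suc n) - 1"
    using step by (intro ln_le_minus_one) simp
  moreover have "real n / real (Suc n) - 1 = - inverse (real (Suc n))"
    by (simp add: field_simps)
  ultimately have "inverse (real (Suc n)) \<le> ln (real (Suc n)) - ln (real n)"
    using step by (simp add: ln_div)
  then show ?case using step.IH by (simp add: harm_Suc)
qed

text \<open>All cross terms of the expanded square are nonnegative. This turns a bound on a sum of
  half gaps into one on the sum of their squares.\<close>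

lemma sum_squares_le_square_sum:
  fixes f :: "'a \<Rightarrow> real"
  assumes "finite A" "\<And>x. x \<in> A \<Longrightarrow> f x \<ge> 0"
  shows "(\<Sum>x\<in>A. (f x)\<^sup>2) \<le> (\<Sum>x\<in>A. f x)\<^sup>2"
proof -
  have "(\<Sum>x\<in>A. (f x)\<^sup>2) \<le> (\<Sum>x\<in>A. f x * (\<Sum>y\<in>A. f y))"
  proof (intro sum_mono)
    fix x assume x: "x \<in> A"
    then have "f x \<le> (\<Sum>y\<in>A. f y)"
      using assms by (intro member_le_sum) auto
    then show "(f x)\<^sup>2 \<le> f x * (\<Sum>y\<in>A. f y)"
      using assms(2)[OF x] by (simp add: power2_eq_square mult_left_mono)
  qed
  then show ?thesis by (simp add: power2_eq_square sum_distrib_right)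
qed

section \<open>Cutting a line between finitely many values\<close>

text \<open>\<open>J\<close> collects the gaps whose midpoint separates \<open>u\<close> from
  \<open>p a\<close>. The way from \<open>p a\<close> to \<open>u\<close> crosses each of them
  completely, except the farthest, of which it crosses at least half. So half of their total length
  fits.\<close>

lemma sum_half_gaps_le:
  fixes p :: "nat \<Rightarrow> real" and u :: real
  assumes strict: "\<And>i j. i < j \<Longrightarrow> j \<le> m \<Longrightarrow> p i < p j" and "a \<le> m"
  defines "J \<equiv> {j. j < m \<and> (u \<le> (p j + p (Suc j)) / 2) \<noteq> (p a \<le> (p j + p (Suc j)) / 2)}"
  shows "(\<Sum>j\<in>J. (p (Suc j) - p j) / 2) \<le> \<bar>u - p a\<bar>"
proof (cases "J = {}")
  case False
  have fin: "finite J" unfolding J_def by auto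
  have mono: "p i \<le> p j" if "i \<le> j" "j \<le> m" for i j
    using strict[of i j] that by (cases "i = j") auto
  have gap: "p j < p (Suc j)" if "j < m" for j using that strict by simp
  have left: "p a \<le> (p j + p (Suc j)) / 2" if "a \<le> j" "j < m" for j
    using mono[of a j] gap[of j] that by auto
  have right: "p (Suc j) \<le> p a" if "j < a" for j
    using mono[of "Suc j" a] that assms(2) by auto
  have telescope: "(\<Sum>j\<in>J. (p (Suc j) - p j) / 2) \<le> (p t - p s) / 2"
    if "J \<subseteq> {s..<t}" "s \<le> t" "t \<le> m" for s t
  proof -
    have "(\<Sum>j\<in>J. (p (Suc j) - p j) / 2) \<le> (\<Sum>j\<in>{s..<t}. (p (Suc j) - p j) / 2)"
      using that gap by (intro sum_mono2) (auto simp: less_imp_le)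
    also have "\<dots> = (p t - p s) / 2"
      using sum_Suc_diff'[OF that(2), of p] by (simp add: sum_divide_distrib[symmetric])
    finally show ?thesis .
  qed
  show ?thesis
  proof (cases "p a < u")
    case True
    define b where "b = Max J"
    have b: "b \<in> J" unfolding b_def using fin False by simp
    have ge: "a \<le> j" if "j \<in> J" for j
    proof (rule ccontr)
      assume "\<not> a \<le> j"
      then have "p (Suc j) \<le> p a" "j < m" "p j < p (Suc j)"
        using right[of j] that gap[of j] unfolding J_def by auto
      then show False using that True unfolding J_def by auto
    qed
    have "J \<subseteq> {a..<Suc b}" using ge fin Max_ge[of J] unfolding b_def by (auto simp: less_Suc_eq_le)
    moreover have "Suc b \<le> m" using b unfolding J_def by auto
    ultimately have "(\<Sum>j\<in>J. (p (Suc j) - p j) / 2) \<le> (p (Suc b) - p a) / 2"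
      using telescope[of a "Suc b"] ge[OF b] by auto
    \<comment> \<open>The last gap may reach beyond \<open>u\<close>, but its midpoint does not; the
      halving absorbs the overhang.\<close>
    moreover have "(p b + p (Suc b)) / 2 < u"
      using b left[of b] ge[OF b] unfolding J_def by auto
    moreover have "p a \<le> p b" using mono[of a b] ge[OF b] \<open>Suc b \<le> m\<close> by auto
    ultimately show ?thesis by (simp add: field_simps)
  next
    case le: False
    \<comment> \<open>Mirror image: now \<open>u \<le> p a\<close>, all of \<open>J\<close> lies
      below \<open>a\<close>, and the leftmost gap is the farthest one.\<close>
    define b where "b = Min J"
    have b: "b \<in> J" unfolding b_def using fin False by simp
    have lt: "j < a" if "j \<in> J" for j
    proof (rule ccontr)
      assume "\<not> j < a"
      then have "p a \<le> (p j + p (Suc j)) / 2" using that left[of j] unfolding J_def by auto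
      then show False using that le unfolding J_def by auto
    qed
    have "J \<subseteq> {b..<a}" using lt fin Min_le[of J] unfolding b_def by auto
    then have "(\<Sum>j\<in>J. (p (Suc j) - p j) / 2) \<le> (p a - p b) / 2"
      using telescope[of b a] lt[OF b] assms(2) by auto
    moreover have "u \<le> (p b + p (Suc b)) / 2"
      using b le unfolding J_def by auto
    moreover have "p (Suc b) \<le> p a" using right lt[OF b] by auto
    ultimately show ?thesis using le by (simp add: field_simps)
  qed
qed simp

text \<open>The reciprocal of a minimum is at most the sum of both reciprocals, and reversing the
  index turns the second sum into the first. The gap \<open>j\<close> among \<open>m\<close> gaps
  has \<open>Suc j\<close> values on its left and \<open>m - j\<close> on its right.\<close>

lemma sum_inverse_min_le_harm:
  "(\<Sum>j<m. 1 / real (min (Suc j) (m - j))) \<le> 2 * harm m"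
proof -
  have "(\<Sum>j<m. 1 / real (min (Suc j) (m - j)))
      \<le> (\<Sum>j<m. inverse (real (Suc j)) + inverse (real (Suc (m - Suc j))))"
  proof (intro sum_mono)
    fix j assume "j \<in> {..<m}"
    then have "Suc (m - Suc j) = m - j" "j \<le> m" by auto
    then show "1 / real (min (Suc j) (m - j))
        \<le> inverse (real (Suc j)) + inverse (real (Suc (m - Suc j)))"
      by (simp add: min_def inverse_eq_divide)
  qed
  also have "\<dots> = 2 * (\<Sum>j<m. inverse (real (Suc j)))"
    using sum.nat_diff_reindex[of "\<lambda>j. inverse (real (Suc j))" m] by (simp add: sum.distrib)
  also have "(\<Sum>j<m. inverse (real (Suc j))) = harm m"
    unfolding harm_def by (simp add: sum.atLeast1_atMost_eq)
  finally show ?thesis .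
qed

lemma finite_set_strict_enumeration:
  fixes V :: "real set"
  assumes "finite V" "card V = Suc m"
  obtains p where "\<And>i j. i < j \<Longrightarrow> j \<le> m \<Longrightarrow> p i < p j" "V = p ` {..m}"
proof
  define xs where "xs = sorted_list_of_set V"
  have len: "length xs = Suc m" and "set xs = V"
    using assms unfolding xs_def by auto
  have "sorted_wrt (<) xs" unfolding xs_def by simp
  with len show "xs ! i < xs ! j" if "i < j" "j \<le> m" for i j
    using that by (simp add: sorted_wrt_nth_less)
  show "V = (!) xs ` {..m}"
    using \<open>set xs = V\<close> len by (auto simp: set_conv_nth less_Suc_eq_le)
qed

text \<open>
  The witness is the midpoint of one of the gaps between consecutive values. If none worked,
  summing over the gaps with weights \<open>gap\<^sup>2\<close> would contradict
  Cauchy--Schwarz in the form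
  \<open>(\<Sum>g\<^sub>j)\<^sup>2 \<le> (\<Sum>c\<^sub>j * g\<^sub>j\<^sup>2) * (\<Sum>1 / c\<^sub>j)\<close>, where \<open>c\<^sub>j\<close> is the size of the smaller side of gap
  \<open>j\<close>, so that \<open>\<Sum>1 / c\<^sub>j\<close> is only logarithmic.
\<close>

lemma balanced_cheap_cut:
  fixes V :: "real set" and u c :: "'a \<Rightarrow> real"
  assumes "finite V" "card V \<ge> 2" "finite X" "c ` X \<subseteq> V"
  obtains \<theta> where "Min V \<le> \<theta>" "\<theta> < Max V"
    "real (card {x \<in> X. (u x \<le> \<theta>) \<noteq> (c x \<le> \<theta>)}) * (Max V - Min V)\<^sup>2
      \<le> 8 * harm (card V) * real (min (card {v \<in> V. v \<le> \<theta>}) (card {v \<in> V. v > \<theta>}))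
          * (\<Sum>x\<in>X. (u x - c x)\<^sup>2)"
proof (rule ccontr)
  assume noex: "\<not> thesis"
  \<comment> \<open>Saved under a name of its own, because \<open>that\<close> is rebound by each
    local \<open>if\<close>.\<close>
  note cutI = that
  obtain m where m: "card V = Suc m" "m \<ge> 1"
    using assms(2) by (metis Suc_le_D Suc_le_mono numeral_2_eq_2 One_nat_def)
  obtain p where p: "\<And>i j. i < j \<Longrightarrow> j \<le> m \<Longrightarrow> p i < p j" and V: "V = p ` {..m}"
    using finite_set_strict_enumeration[OF assms(1) m(1)] by blast
  have pmono: "p i \<le> p j" if "i \<le> j" "j \<le> m" for i j
    using p[of i j] that by (cases "i = j") auto
  have MinV: "Min V = p 0"
    unfolding V by (intro Min_eqI) (auto intro: pmono)
  have MaxV: "Max V = p m"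
    unfolding V by (intro Max_eqI) (auto intro: pmono)
  define L where "L = Max V - Min V"
  define cst where "cst = (\<Sum>x\<in>X. (u x - c x)\<^sup>2)"
  define mid where "mid j = (p j + p (Suc j)) / 2" for j
  define g where "g j = p (Suc j) - p j" for j
  define F where "F j = real (card {x \<in> X. (u x \<le> mid j) \<noteq> (c x \<le> mid j)})" for j
  define cnt where "cnt j = real (min (Suc j) (m - j))" for j
  have gpos: "g j > 0" if "j < m" for j using p[of j "Suc j"] that unfolding g_def by auto
  have L: "L = (\<Sum>j<m. g j)"
    unfolding L_def g_def MinV MaxV by (simp add: sum_lessThan_telescope)
  have cst0: "cst \<ge> 0" unfolding cst_def by (simp add: sum_nonneg)
  have harm0: "harm m > (0::real)" using m by (simp add: harm_pos)
  \<comment> \<open>Each midpoint lies in the admissible range, so by assumption it violates the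
    bound. Weakening \<open>card V = Suc m\<close> to \<open>m\<close> in the harmonic number fits
    the number of gaps.\<close>
  have expensive: "F j * L\<^sup>2 > 8 * harm m * cnt j * cst" if j: "j < m" for j
  proof -
    have lt: "p j < mid j" "mid j < p (Suc j)" using p[of j "Suc j"] j unfolding mid_def by auto
    have le: "Min V \<le> mid j" "mid j < Max V"
      using lt pmono[of 0 j] pmono[of "Suc j" m] j unfolding MinV MaxV by auto
    have inj: "inj_on p {..m}"
      by (rule inj_onI) (metis p atMost_iff linorder_neqE_nat order_less_irrefl)
    have "p ` {..j} \<subseteq> {v \<in> V. v \<le> mid j}"
      using lt pmono[of _ j] j unfolding V by fastforce
    then have "card (p ` {..j}) \<le> card {v \<in> V. v \<le> mid j}"
      using assms(1) by (intro card_mono) auto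
    moreover have "card (p ` {..j}) = Suc j"
      using inj j by (subst card_image) (auto intro: inj_on_subset)
    moreover have "p ` {Suc j..m} \<subseteq> {v \<in> V. v > mid j}"
      using lt pmono[of "Suc j"] j unfolding V by fastforce
    then have "card (p ` {Suc j..m}) \<le> card {v \<in> V. v > mid j}"
      using assms(1) by (intro card_mono) auto
    moreover have "card (p ` {Suc j..m}) = m - j"
      using inj j by (subst card_image) (auto intro: inj_on_subset)
    ultimately have cnt: "cnt j \<le> real (min (card {v \<in> V. v \<le> mid j}) (card {v \<in> V. v > mid j}))"
      unfolding cnt_def by auto
    have "F j * L\<^sup>2 > 8 * harm (card V)
        * real (min (card {v \<in> V. v \<le> mid j}) (card {v \<in> V. v > mid j})) * cst"
      using noex cutI[OF le] unfolding F_def L_def cst_def by fastforce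
    moreover have "8 * harm m * cnt j * cst \<le> 8 * harm (card V)
        * real (min (card {v \<in> V. v \<le> mid j}) (card {v \<in> V. v > mid j})) * cst"
      using cnt cst0 harm_mono[of m "card V"] m harm0
      by (intro mult_mono) (auto simp: cnt_def intro!: mult_nonneg_nonneg harm_nonneg)
    ultimately show ?thesis by linarith
  qed
  \<comment> \<open>Double counting of pairs of a gap and a point separated by it: for a fixed point
    the half gaps add up to at most its displacement, and squaring the factor 2 gives the 4.\<close>
  have "(\<Sum>j<m. F j * (g j)\<^sup>2) \<le> 4 * cst"
  proof -
    have "F j * (g j)\<^sup>2 =
      (\<Sum>x\<in>X. if (u x \<le> mid j) \<noteq> (c x \<le> mid j) then (g j)\<^sup>2 else 0)" for j
      unfolding F_def using assms(3) by (simp add: sum.If_cases Int_def)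
    then have "(\<Sum>j<m. F j * (g j)\<^sup>2) =
      (\<Sum>x\<in>X. \<Sum>j<m. if (u x \<le> mid j) \<noteq> (c x \<le> mid j) then (g j)\<^sup>2 else 0)"
      by (simp only: sum.swap[of _ X])
    also have "\<dots> \<le> (\<Sum>x\<in>X. 4 * (u x - c x)\<^sup>2)"
    proof (intro sum_mono)
      fix x assume "x \<in> X"
      then obtain a where a: "c x = p a" "a \<le> m" using assms(4) V by auto
      define J where "J = {j. j < m \<and> (u x \<le> mid j) \<noteq> (p a \<le> mid j)}"
      have fin: "finite J" unfolding J_def by auto
      have "(\<Sum>j<m. if (u x \<le> mid j) \<noteq> (c x \<le> mid j) then (g j)\<^sup>2 else 0) = (\<Sum>j\<in>J. (g j)\<^sup>2)"
        unfolding a J_def by (subst sum.inter_filter[symmetric]) (auto intro: sum.cong)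
      also have "\<dots> = 4 * (\<Sum>j\<in>J. (g j / 2)\<^sup>2)"
        by (simp add: power_divide sum_distrib_left)
      also have "(\<Sum>j\<in>J. (g j / 2)\<^sup>2) \<le> (\<Sum>j\<in>J. g j / 2)\<^sup>2"
        using fin gpos by (intro sum_squares_le_square_sum) (auto simp: J_def less_imp_le)
      also have "(\<Sum>j\<in>J. g j / 2) \<le> \<bar>u x - p a\<bar>"
        using sum_half_gaps_le[of m p a "u x"] p a(2) unfolding J_def g_def mid_def by blast
      then have "(\<Sum>j\<in>J. g j / 2)\<^sup>2 \<le> \<bar>u x - p a\<bar>\<^sup>2"
        using gpos by (intro power_mono sum_nonneg) (auto simp: J_def less_imp_le)
      finally show "(\<Sum>j<m. if (u x \<le> mid j) \<noteq> (c x \<le> mid j) then (g j)\<^sup>2 else 0)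
          \<le> 4 * (u x - c x)\<^sup>2" using a by simp
    qed
    also have "\<dots> = 4 * cst" unfolding cst_def by (simp add: sum_distrib_left)
    finally show ?thesis .
  qed
  then have upper: "(\<Sum>j<m. F j * (g j)\<^sup>2) * L\<^sup>2 \<le> 4 * cst * L\<^sup>2"
    by (intro mult_right_mono) auto
  \<comment> \<open>The constant 8 is the 4 of the double counting times the 2 in the bound
    \<open>2 * harm m\<close> on the sum of reciprocals.\<close>
  have "4 * cst * ((\<Sum>j<m. cnt j * (g j)\<^sup>2) * (2 * harm m))
      = (\<Sum>j<m. (8 * harm m * cnt j * cst) * (g j)\<^sup>2)"
    by (simp add: sum_distrib_left mult_ac)
  also have "\<dots> < (\<Sum>j<m. (F j * L\<^sup>2) * (g j)\<^sup>2)"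
  proof (rule sum_strict_mono)
    show "{..<m} \<noteq> {}" using m(2) by (simp add: lessThan_empty_iff)
    show "(8 * harm m * cnt j * cst) * (g j)\<^sup>2 < (F j * L\<^sup>2) * (g j)\<^sup>2" if "j \<in> {..<m}" for j
      using expensive[of j] gpos[of j] that by (intro mult_strict_right_mono) auto
  qed simp
  also have "\<dots> = (\<Sum>j<m. F j * (g j)\<^sup>2) * L\<^sup>2"
    by (simp add: sum_distrib_left mult_ac)
  also note upper
  finally have strict: "4 * cst * ((\<Sum>j<m. cnt j * (g j)\<^sup>2) * (2 * harm m)) < 4 * cst * L\<^sup>2" .
  have cntpos: "cnt j > 0" if "j < m" for j using that unfolding cnt_def by auto
  have "L = (\<Sum>j<m. (sqrt (cnt j) * g j) * (1 / sqrt (cnt j)))"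
    unfolding L using cntpos by (intro sum.cong refl) (simp add: less_imp_neq[symmetric])
  then have "L\<^sup>2 \<le> (\<Sum>j<m. (sqrt (cnt j) * g j)\<^sup>2) * (\<Sum>j<m. (1 / sqrt (cnt j))\<^sup>2)"
    using Cauchy_Schwarz_ineq_sum[of "\<lambda>j. sqrt (cnt j) * g j" "\<lambda>j. 1 / sqrt (cnt j)" "{..<m}"]
    by simp
  also have "\<dots> = (\<Sum>j<m. cnt j * (g j)\<^sup>2) * (\<Sum>j<m. 1 / cnt j)"
    by (simp add: cnt_def power_mult_distrib power_divide)
  also have "\<dots> \<le> (\<Sum>j<m. cnt j * (g j)\<^sup>2) * (2 * harm m)"
    using sum_inverse_min_le_harm[of m]
    by (intro mult_left_mono sum_nonneg) (auto simp: cnt_def)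
  finally have "4 * cst * L\<^sup>2 \<le> 4 * cst * ((\<Sum>j<m. cnt j * (g j)\<^sup>2) * (2 * harm m))"
    using cst0 by (intro mult_left_mono) auto
  with strict show False by linarith
qed

section \<open>Growing the tree on a set of centers\<close>

lemma leaf_cells_subset: "C \<in> leaf_cells T Z \<Longrightarrow> C \<subseteq> Z"
  by (induction T Z arbitrary: C rule: leaf_cells.induct) fastforce+

lemma valid_tree_Leaf [simp]: "valid_tree d Leaf"
  and valid_tree_Node [simp]: "valid_tree d (Node l (i, \<theta>) r) \<longleftrightarrow>
    i \<in> {1..d} \<and> valid_tree d l \<and> valid_tree d r"
  unfolding valid_tree_def by auto

text \<open>In every coordinate two points of \<open>S\<close> differ by at most the largest width,
  and there are \<open>d\<close> coordinates. That width is positive since distinct points differ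
  somewhere, so a cut in this coordinate can split \<open>S\<close>.\<close>

lemma widest_coordinate:
  assumes "finite S" "S \<subseteq> Rn d" "card S \<ge> 2"
  obtains i where "i \<in> {1..d}" "card ((\<lambda>s. s i) ` S) \<ge> 2"
    "\<And>s t. s \<in> S \<Longrightarrow> t \<in> S \<Longrightarrow>
      (dist2 d s t)\<^sup>2 \<le> real d * (Max ((\<lambda>s. s i) ` S) - Min ((\<lambda>s. s i) ` S))\<^sup>2"
proof -
  define V where "V i = (\<lambda>s. s i) ` S" for i
  define w where "w i = Max (V i) - Min (V i)" for i
  have fin: "finite (V i)" for i unfolding V_def using assms by auto
  have diff: "\<bar>s i - t i\<bar> \<le> w i" if "s \<in> S" "t \<in> S" for s t i
  proof -
    have "s i \<in> V i" "t i \<in> V i" using that unfolding V_def by auto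
    then show ?thesis
      using fin[of i] Max_ge[OF fin] Min_le[OF fin] unfolding w_def by (smt (verit))
  qed
  obtain s t where st: "s \<in> S" "t \<in> S" "s \<noteq> t"
    using assms(3) by (metis card_2_iff' obtain_subset_with_card_n subsetD)
  obtain i0 where i0: "i0 \<in> {1..d}" "s i0 \<noteq> t i0"
    using Rn_distinct_coordinate[of s d t] st assms(2) by blast
  have "Max (w ` {1..d}) \<in> w ` {1..d}" using i0(1) by (intro Max_in) auto
  then obtain i where i: "i \<in> {1..d}" "w i = Max (w ` {1..d})" by auto
  then have max: "w j \<le> w i" if "j \<in> {1..d}" for j using that by simp
  have wpos: "w i > 0" using diff[OF st(1,2), of i0] max[OF i0(1)] i0(2) by auto
  have "V i \<noteq> {}" using st unfolding V_def by auto
  then have "{Min (V i), Max (V i)} \<subseteq> V i" using fin by auto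
  then have "card {Min (V i), Max (V i)} \<le> card (V i)" using fin by (intro card_mono)
  then have "card (V i) \<ge> 2" using wpos unfolding w_def by auto
  moreover have "(dist2 d s t)\<^sup>2 \<le> real d * (w i)\<^sup>2" if "s \<in> S" "t \<in> S" for s t
  proof -
    have "(s j - t j)\<^sup>2 \<le> (w i)\<^sup>2" if "j \<in> {1..d}" for j
      using diff[OF \<open>s \<in> S\<close> \<open>t \<in> S\<close>, of j] max[OF that] by (simp add: abs_le_square_iff[symmetric])
    then have "(\<Sum>j=1..d. (s j - t j)\<^sup>2) \<le> (\<Sum>j=1..d. (w i)\<^sup>2)" by (intro sum_mono)
    then show ?thesis by (simp add: dist2_squared)
  qed
  ultimately show thesis using that i(1) unfolding V_def w_def by blast
qed

text \<open>Constancy of \<open>rep\<close> is claimed for the cells of every \<open>Z\<close>, not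
  only of \<open>X\<close>: the recursion drops separated points from the cost bound, yet they still
  fall into cells of the subtrees. The bound \<open>k\<close> stays fixed while \<open>S\<close>
  shrinks, so the harmonic factor is the same at all levels.\<close>

lemma tree_for_centers:
  assumes "finite S" "S \<noteq> {}" "S \<subseteq> Rn d" "card S \<le> k" "finite X" "c ` X \<subseteq> S"
  shows "\<exists>T rep. valid_tree d T \<and> size1 T = card S \<and> range rep \<subseteq> S \<and>
    (\<forall>Z. \<forall>C\<in>leaf_cells T Z. \<forall>x\<in>C. \<forall>y\<in>C. rep x = rep y) \<and>
    (\<Sum>x\<in>X. (dist2 d x (rep x))\<^sup>2)
      \<le> (2 + 16 * harm k * real d * real (card S)) * (\<Sum>x\<in>X. (dist2 d x (c x))\<^sup>2)"
  using assms
proof (induction "card S" arbitrary: S X rule: less_induct)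
  case less
  note finS = less.prems(1) and finX = less.prems(5)
  have harm0: "harm k \<ge> (0::real)" by (rule harm_nonneg)
  show ?case
  proof (cases "card S \<ge> 2")
    case False
    then have "card S = 1" using less.prems by (metis Suc_1 card_0_eq less_2_cases not_le One_nat_def)
    then obtain s where S: "S = {s}" by (auto simp: card_1_singleton_iff)
    have "(\<Sum>x\<in>X. (dist2 d x s)\<^sup>2) = (\<Sum>x\<in>X. (dist2 d x (c x))\<^sup>2)" (is "?A = ?B")
      using less.prems(6) S by (intro sum.cong) auto
    moreover have "1 * ?B \<le> (2 + 16 * harm k * real d * real (card S)) * ?B"
      using harm0 by (intro mult_right_mono sum_nonneg) auto
    ultimately show ?thesis
      using S by (intro exI[of _ Leaf] exI[of _ "\<lambda>_. s"]) auto
  next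
    case True
    obtain i where i: "i \<in> {1..d}" "card ((\<lambda>s. s i) ` S) \<ge> 2"
      and wide: "\<And>s t. s \<in> S \<Longrightarrow> t \<in> S \<Longrightarrow>
        (dist2 d s t)\<^sup>2 \<le> real d * (Max ((\<lambda>s. s i) ` S) - Min ((\<lambda>s. s i) ` S))\<^sup>2"
      using widest_coordinate[OF less.prems(1,3) True] by blast
    define V where "V = (\<lambda>s. s i) ` S"
    define L where "L = Max V - Min V"
    define D where "D x = (dist2 d x (c x))\<^sup>2" for x
    have D0: "D x \<ge> 0" for x unfolding D_def by simp
    have finV: "finite V" and V2: "card V \<ge> 2" using i finS unfolding V_def by auto
    have cV: "(\<lambda>x. c x i) ` X \<subseteq> V" using less.prems(6) unfolding V_def by auto
    obtain \<theta> where \<theta>: "Min V \<le> \<theta>" "\<theta> < Max V" and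
      cut: "real (card {x \<in> X. (x i \<le> \<theta>) \<noteq> (c x i \<le> \<theta>)}) * L\<^sup>2
        \<le> 8 * harm (card V) * real (min (card {v \<in> V. v \<le> \<theta>}) (card {v \<in> V. v > \<theta>}))
          * (\<Sum>x\<in>X. (x i - c x i)\<^sup>2)"
      using balanced_cheap_cut[OF finV V2 finX cV, of "\<lambda>x. x i"] unfolding L_def by blast
    define Sl Sr where "Sl = {s \<in> S. s i \<le> \<theta>}" and "Sr = {s \<in> S. s i > \<theta>}"
    \<comment> \<open>Only points on the side of their own center are passed on, as the induction
      needs the centers of the points inside \<open>Sl\<close> or \<open>Sr\<close>. The points of
      \<open>Y\<close> are paid for at this node.\<close>
    define Xl Xr where "Xl = {x \<in> X. x i \<le> \<theta> \<and> c x i \<le> \<theta>}"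
      and "Xr = {x \<in> X. x i > \<theta> \<and> c x i > \<theta>}"
    define Y where "Y = {x \<in> X. (x i \<le> \<theta>) \<noteq> (c x i \<le> \<theta>)}"
    have S_split: "S = Sl \<union> Sr" "Sl \<inter> Sr = {}" "finite Sl" "finite Sr"
      using finS unfolding Sl_def Sr_def by auto
    have X_split: "X = Y \<union> (Xl \<union> Xr)" "Xl \<inter> Xr = {}" "Y \<inter> (Xl \<union> Xr) = {}"
      "finite Xl" "finite Xr" "finite Y"
      using finX unfolding Xl_def Xr_def Y_def by auto
    have "V \<noteq> {}" using V2 by auto
    then have "Min V \<in> V" "Max V \<in> V" using finV by auto
    then have ne: "Sl \<noteq> {}" "Sr \<noteq> {}"
      using \<theta> unfolding V_def Sl_def Sr_def by force+
    have card_S: "card S = card Sl + card Sr" using S_split by (simp add: card_Un_disjoint)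
    have card_pos: "card Sl > 0" "card Sr > 0" using ne S_split by (auto simp: card_gt_0_iff)
    have "c ` Xl \<subseteq> Sl" "c ` Xr \<subseteq> Sr"
      using less.prems(6) unfolding Xl_def Xr_def Sl_def Sr_def by auto
    moreover have "Sl \<subseteq> Rn d" "Sr \<subseteq> Rn d" using less.prems(3) S_split by auto
    moreover have "card Sl < card S" "card Sr < card S" "card Sl \<le> k" "card Sr \<le> k"
      using card_S card_pos less.prems(4) by auto
    ultimately have "\<exists>T rep. valid_tree d T \<and> size1 T = card S' \<and> range rep \<subseteq> S' \<and>
        (\<forall>Z. \<forall>C\<in>leaf_cells T Z. \<forall>x\<in>C. \<forall>y\<in>C. rep x = rep y) \<and>
        (\<Sum>x\<in>X'. (dist2 d x (rep x))\<^sup>2)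
          \<le> (2 + 16 * harm k * real d * real (card S')) * (\<Sum>x\<in>X'. D x)"
      if "(S', X') = (Sl, Xl) \<or> (S', X') = (Sr, Xr)" for S' X'
      using that less.hyps[of S' X'] ne S_split(3,4) X_split(4,5) unfolding D_def by blast
    from this[of Sl Xl] this[of Sr Xr] obtain Tl repl Tr repr where
      Tl: "valid_tree d Tl" "size1 Tl = card Sl" "range repl \<subseteq> Sl"
        "\<forall>Z. \<forall>C\<in>leaf_cells Tl Z. \<forall>x\<in>C. \<forall>y\<in>C. repl x = repl y"
        "(\<Sum>x\<in>Xl. (dist2 d x (repl x))\<^sup>2)
          \<le> (2 + 16 * harm k * real d * real (card Sl)) * (\<Sum>x\<in>Xl. D x)" and
      Tr: "valid_tree d Tr" "size1 Tr = card Sr" "range repr \<subseteq> Sr"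
        "\<forall>Z. \<forall>C\<in>leaf_cells Tr Z. \<forall>x\<in>C. \<forall>y\<in>C. repr x = repr y"
        "(\<Sum>x\<in>Xr. (dist2 d x (repr x))\<^sup>2)
          \<le> (2 + 16 * harm k * real d * real (card Sr)) * (\<Sum>x\<in>Xr. D x)"
      by auto
    \<comment> \<open>The side of the point itself decides, so a point of \<open>Y\<close> gets a
      center across the cut from its own.\<close>
    define rep where "rep x = (if x i \<le> \<theta> then repl x else repr x)" for x
    have range: "range rep \<subseteq> S" using Tl(3) Tr(3) S_split unfolding rep_def by auto
    have const: "rep x = rep y"
      if "C \<in> leaf_cells (Node Tl (i, \<theta>) Tr) Z" "x \<in> C" "y \<in> C" for Z C x y
    proof -
      consider "C \<in> leaf_cells Tl {x \<in> Z. x i \<le> \<theta>}" | "C \<in> leaf_cells Tr {x \<in> Z. x i > \<theta>}"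
        using \<open>C \<in> leaf_cells (Node Tl (i, \<theta>) Tr) Z\<close> by auto
      then show ?thesis
      proof cases
        case 1
        then have "x i \<le> \<theta>" "y i \<le> \<theta>" using leaf_cells_subset[OF 1] that(2,3) by auto
        moreover have "repl x = repl y" using Tl(4) 1 that(2,3) by blast
        ultimately show ?thesis unfolding rep_def by simp
      next
        case 2
        then have "x i > \<theta>" "y i > \<theta>" using leaf_cells_subset[OF 2] that(2,3) by auto
        moreover have "repr x = repr y" using Tr(4) 2 that(2,3) by blast
        ultimately show ?thesis unfolding rep_def by simp
      qed
    qed
    define q where "q = real (min (card Sl) (card Sr))"
    \<comment> \<open>\<open>card S - q\<close> is the number of centers on the larger side, so
      \<open>B\<close> dominates the factors of both children.\<close>
    define B where "B = 2 + 16 * harm k * real d * (real (card S) - q)"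
    have B2: "B \<ge> 2" unfolding B_def q_def card_S using harm0 by simp
    have sides: "2 + 16 * harm k * real d * real (card Sl) \<le> B"
      "2 + 16 * harm k * real d * real (card Sr) \<le> B"
      unfolding B_def q_def card_S using harm0 by (auto intro!: mult_left_mono)
    have sep: "(\<Sum>x\<in>Y. (dist2 d x (rep x))\<^sup>2) \<le> (\<Sum>x\<in>Y. 2 * D x + 2 * (real d * L\<^sup>2))"
    proof (intro sum_mono)
      fix x assume "x \<in> Y"
      then have "c x \<in> S" "rep x \<in> S" using less.prems(6) range unfolding Y_def by auto
      then show "(dist2 d x (rep x))\<^sup>2 \<le> 2 * D x + 2 * (real d * L\<^sup>2)"
        using wide[of "c x" "rep x"] dist2_squared_triangle[of d x "rep x" "c x"]
        unfolding D_def L_def V_def by linarith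
    qed
    have sep_eq: "(\<Sum>x\<in>Y. 2 * D x + 2 * (real d * L\<^sup>2))
        = 2 * (\<Sum>x\<in>Y. D x) + 2 * real d * (real (card Y) * L\<^sup>2)"
      by (simp add: sum.distrib sum_distrib_left)
    have "real (card Y) * L\<^sup>2 \<le> 8 * harm k * q * (\<Sum>x\<in>X. D x)"
    proof -
      \<comment> \<open>The cut was balanced with respect to distinct coordinate values; projecting
        can only merge centers, so the value counts are at most the center counts.\<close>
      have "{v \<in> V. v \<le> \<theta>} = (\<lambda>s. s i) ` Sl" "{v \<in> V. v > \<theta>} = (\<lambda>s. s i) ` Sr"
        unfolding V_def Sl_def Sr_def by auto
      then have "card {v \<in> V. v \<le> \<theta>} \<le> card Sl" "card {v \<in> V. v > \<theta>} \<le> card Sr"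
        using S_split by (auto intro: card_image_le)
      then have "real (min (card {v \<in> V. v \<le> \<theta>}) (card {v \<in> V. v > \<theta>})) \<le> q"
        unfolding q_def by auto
      moreover have "card V \<le> k" using card_image_le[OF finS] less.prems(4) unfolding V_def
        by (rule order_trans)
      then have "harm (card V) \<le> (harm k :: real)" by (rule harm_mono)
      moreover have "(x i - c x i)\<^sup>2 \<le> D x" for x
        unfolding D_def dist2_squared using i(1)
        by (intro member_le_sum[of i "{1..d}" "\<lambda>i. (x i - c x i)\<^sup>2"]) auto
      then have "(\<Sum>x\<in>X. (x i - c x i)\<^sup>2) \<le> (\<Sum>x\<in>X. D x)" by (intro sum_mono)
      ultimately have "8 * harm (card V) * real (min (card {v \<in> V. v \<le> \<theta>}) (card {v \<in> V. v > \<theta>}))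
          * (\<Sum>x\<in>X. (x i - c x i)\<^sup>2) \<le> 8 * harm k * q * (\<Sum>x\<in>X. D x)"
        using harm0 by (intro mult_mono) (auto simp: q_def intro: sum_nonneg harm_nonneg)
      then show ?thesis using cut unfolding Y_def by linarith
    qed
    then have "2 * real d * (real (card Y) * L\<^sup>2) \<le> 2 * real d * (8 * harm k * q * (\<Sum>x\<in>X. D x))"
      by (rule mult_left_mono) simp
    also have "\<dots> = 16 * harm k * real d * q * (\<Sum>x\<in>X. D x)" by simp
    finally have Ybound: "(\<Sum>x\<in>Y. (dist2 d x (rep x))\<^sup>2)
        \<le> 2 * (\<Sum>x\<in>Y. D x) + 16 * harm k * real d * q * (\<Sum>x\<in>X. D x)"
      using sep sep_eq by linarith
    have "(\<Sum>x\<in>Xl. (dist2 d x (rep x))\<^sup>2) = (\<Sum>x\<in>Xl. (dist2 d x (repl x))\<^sup>2)"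
      unfolding rep_def Xl_def by (intro sum.cong) auto
    also have "\<dots> \<le> B * (\<Sum>x\<in>Xl. D x)"
      using Tl(5) sides(1) D0 by (meson mult_right_mono order_trans sum_nonneg)
    finally have lbound: "(\<Sum>x\<in>Xl. (dist2 d x (rep x))\<^sup>2) \<le> B * (\<Sum>x\<in>Xl. D x)" .
    have "(\<Sum>x\<in>Xr. (dist2 d x (rep x))\<^sup>2) = (\<Sum>x\<in>Xr. (dist2 d x (repr x))\<^sup>2)"
      unfolding rep_def Xr_def by (intro sum.cong) auto
    also have "\<dots> \<le> B * (\<Sum>x\<in>Xr. D x)"
      using Tr(5) sides(2) D0 by (meson mult_right_mono order_trans sum_nonneg)
    finally have rbound: "(\<Sum>x\<in>Xr. (dist2 d x (rep x))\<^sup>2) \<le> B * (\<Sum>x\<in>Xr. D x)" .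
    have split: "(\<Sum>x\<in>X. f x) = (\<Sum>x\<in>Y. f x) + ((\<Sum>x\<in>Xl. f x) + (\<Sum>x\<in>Xr. f x))"
      for f :: "(nat \<Rightarrow> real) \<Rightarrow> real"
      using X_split by (metis finite_UnI sum.union_disjoint)
    have "2 * (\<Sum>x\<in>Y. D x) \<le> B * (\<Sum>x\<in>Y. D x)"
      using B2 D0 by (intro mult_right_mono sum_nonneg) auto
    then have "(\<Sum>x\<in>X. (dist2 d x (rep x))\<^sup>2)
      \<le> B * (\<Sum>x\<in>Y. D x) + 16 * harm k * real d * q * (\<Sum>x\<in>X. D x)
        + (B * (\<Sum>x\<in>Xl. D x) + B * (\<Sum>x\<in>Xr. D x))"
      using split[of "\<lambda>x. (dist2 d x (rep x))\<^sup>2"] Ybound lbound rbound by linarith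
    also have "\<dots> = (B + 16 * harm k * real d * q) * (\<Sum>x\<in>X. D x)"
      unfolding split[of D] by (simp add: algebra_simps)
    \<comment> \<open>The \<open>q\<close> centers saved in \<open>B\<close> pay exactly for the
      separated points; 16 is the 8 of the cut times the 2 of the squared triangle
      inequality.\<close>
    also have "B + 16 * harm k * real d * q = 2 + 16 * harm k * real d * real (card S)"
      unfolding B_def by (simp add: algebra_simps)
    finally have bound: "(\<Sum>x\<in>X. (dist2 d x (rep x))\<^sup>2)
      \<le> (2 + 16 * harm k * real d * real (card S)) * (\<Sum>x\<in>X. D x)" .
    have "valid_tree d (Node Tl (i, \<theta>) Tr)" "size1 (Node Tl (i, \<theta>) Tr) = card S"
      using Tl(1,2) Tr(1,2) i(1) card_S by simp_all
    with const range bound[unfolded D_def] show ?thesis by blast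
  qed
qed

section \<open>Trees with a prescribed number of nonempty cells\<close>

text \<open>Each of the \<open>n\<close> leaves receives a point of \<open>X\<close>, which is what
  \<open>clustering\<close> and \<open>explainable\<close> jointly ask of a tree.\<close>

definition tree_partition :: "nat \<Rightarrow> nat \<Rightarrow> (nat \<Rightarrow> real) set \<Rightarrow> decision_tree \<Rightarrow> bool" where
  "tree_partition d n X T \<longleftrightarrow> valid_tree d T \<and> size1 T = n \<and>
    partition_on X (leaf_cells T X) \<and> card (leaf_cells T X) = n"

text \<open>A cell common to both subtrees would lie on both sides of the cut and be empty, so the
  cell counts add up.\<close>

lemma tree_partition_Node:
  assumes "finite X" "i \<in> {1..d}"
    "tree_partition d n1 {x \<in> X. x i \<le> \<theta>} l" "tree_partition d n2 {x \<in> X. x i > \<theta>} r"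
  shows "tree_partition d (n1 + n2) X (Node l (i, \<theta>) r)"
proof -
  let ?A = "{x \<in> X. x i \<le> \<theta>}" and ?B = "{x \<in> X. x i > \<theta>}"
  let ?P = "leaf_cells l ?A" and ?Q = "leaf_cells r ?B"
  have P: "partition_on ?A ?P" and Q: "partition_on ?B ?Q"
    using assms unfolding tree_partition_def by auto
  have disj: "?A \<inter> ?B = {}" and un: "?A \<union> ?B = X" by auto
  have "finite ?P" "finite ?Q" using finite_elements[OF _ P] finite_elements[OF _ Q] assms(1) by simp_all
  moreover have "?P \<inter> ?Q = {}"
  proof (rule ccontr)
    assume "?P \<inter> ?Q \<noteq> {}"
    then obtain C where "C \<in> ?P" "C \<in> ?Q" by blast
    then have "C \<subseteq> ?A \<inter> ?B" using leaf_cells_subset[of C] by auto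
    then show False using disj \<open>C \<in> ?P\<close> partition_onD3[OF P] by auto
  qed
  moreover have "partition_on X (?P \<union> ?Q)"
    using disjoint_union[of ?P ?Q] P Q disj un by (simp add: partition_on_def)
  ultimately show ?thesis
    using assms unfolding tree_partition_def by (simp add: card_Un_disjoint)
qed

text \<open>Cutting between two distinct points leaves both sides nonempty, and the \<open>n\<close>
  groups are distributed over the sides.\<close>

lemma tree_partition_exists:
  assumes "finite X" "X \<subseteq> Rn d" "1 \<le> n" "n \<le> card X"
  shows "\<exists>T. tree_partition d n X T"
  using assms
proof (induction "card X" arbitrary: X n rule: less_induct)
  case less
  show ?case
  proof (cases "n = 1")
    case True
    then have "tree_partition d n X Leaf"
      using less.prems by (auto simp: tree_partition_def partition_on_def)
    then show ?thesis by blast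
  next
    case False
    then have "card X \<ge> 2" using less.prems by simp
    then obtain y z where "y \<in> X" "z \<in> X" "y \<noteq> z"
      by (metis card_2_iff' obtain_subset_with_card_n subsetD)
    then obtain i where i: "i \<in> {1..d}" "y i \<noteq> z i"
      using Rn_distinct_coordinate less.prems(2) by blast
    define \<theta> where "\<theta> = min (y i) (z i)"
    let ?A = "{x \<in> X. x i \<le> \<theta>}" and ?B = "{x \<in> X. x i > \<theta>}"
    have "X = ?A \<union> ?B" by auto
    moreover have "card (?A \<union> ?B) = card ?A + card ?B"
      using less.prems(1) by (intro card_Un_disjoint) auto
    ultimately have card: "card X = card ?A + card ?B" by simp
    have "{y, z} \<inter> ?A \<noteq> {}" "{y, z} \<inter> ?B \<noteq> {}"
      using \<open>y \<in> X\<close> \<open>z \<in> X\<close> i(2) unfolding \<theta>_def by auto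
    then have "?A \<noteq> {}" "?B \<noteq> {}" by blast+
    then have pos: "card ?A \<ge> 1" "card ?B \<ge> 1"
      using less.prems(1) by (simp_all add: Suc_le_eq card_gt_0_iff)
    \<comment> \<open>The left side gets as many groups as it can hold while one remains for the
      right; \<open>n \<le> card X\<close> keeps the rest within \<open>card ?B\<close>.\<close>
    define n1 where "n1 = min (card ?A) (n - 1)"
    have n: "1 \<le> n1" "n1 \<le> card ?A" "1 \<le> n - n1" "n - n1 \<le> card ?B" "n1 + (n - n1) = n"
      using pos card less.prems(3,4) False unfolding n1_def by linarith+
    have smaller: "card ?A < card X" "card ?B < card X" using card pos by linarith+
    have sub: "finite ?A" "?A \<subseteq> Rn d" "finite ?B" "?B \<subseteq> Rn d" using less.prems(1,2) by auto
    obtain l r where "tree_partition d n1 ?A l" "tree_partition d (n - n1) ?B r"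
      using less.hyps[OF smaller(1) sub(1,2) n(1,2)] less.hyps[OF smaller(2) sub(3,4) n(3,4)] by blast
    from tree_partition_Node[OF less.prems(1) i(1) this] show ?thesis
      unfolding n(5) by blast
  qed
qed

text \<open>The tree is followed downwards, nodes with an empty side are dropped, and leaves are
  refined further. The minimum in the hypothesis bounds the number of nonempty cells; it passes to
  subtrees even if they have more leaves than points.\<close>

lemma tree_partition_refines:
  assumes "finite X" "X \<subseteq> Rn d" "1 \<le> n" "n \<le> card X"
    "valid_tree d T" "min (size1 T) (card X) \<le> n"
  shows "\<exists>T'. tree_partition d n X T' \<and> (\<forall>C\<in>leaf_cells T' X. \<exists>D\<in>leaf_cells T X. C \<subseteq> D)"
  using assms
proof (induction T arbitrary: X n)
  case Leaf
  then show ?case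
    using tree_partition_exists[OF Leaf.prems(1-4)] leaf_cells_subset by fastforce
next
  case (Node l it r)
  obtain i \<theta> where it: "it = (i, \<theta>)" by (cases it)
  let ?A = "{x \<in> X. x i \<le> \<theta>}" and ?B = "{x \<in> X. x i > \<theta>}"
  have sub: "?A \<subseteq> Rn d" "?B \<subseteq> Rn d" and fin: "finite ?A" "finite ?B"
    and valid: "valid_tree d l" "valid_tree d r" "i \<in> {1..d}"
    using Node.prems it by auto
  have un: "X = ?A \<union> ?B" by auto
  have "card (?A \<union> ?B) = card ?A + card ?B"
    using fin by (intro card_Un_disjoint) auto
  then have card: "card X = card ?A + card ?B" using un by simp
  consider "?A = {}" | "?B = {}" | "?A \<noteq> {}" "?B \<noteq> {}" by blast
  then show ?case
  proof cases
    case 1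
    then have eq: "?B = X" using un by blast
    have "size1 r \<le> size1 (Node l it r)" by simp
    then have "min (size1 r) (card X) \<le> n" using Node.prems(6) by linarith
    then obtain T' where "tree_partition d n X T'"
      "\<forall>C\<in>leaf_cells T' X. \<exists>D\<in>leaf_cells r X. C \<subseteq> D"
      using Node.IH(2)[OF Node.prems(1-4) valid(2)] by blast
    moreover have "leaf_cells r X \<subseteq> leaf_cells (Node l it r) X" unfolding it by (simp add: eq)
    ultimately show ?thesis by blast
  next
    case 2
    then have eq: "?A = X" using un by blast
    have "size1 l \<le> size1 (Node l it r)" by simp
    then have "min (size1 l) (card X) \<le> n" using Node.prems(6) by linarith
    then obtain T' where "tree_partition d n X T'"
      "\<forall>C\<in>leaf_cells T' X. \<exists>D\<in>leaf_cells l X. C \<subseteq> D"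
      using Node.IH(1)[OF Node.prems(1-4) valid(1)] by blast
    moreover have "leaf_cells l X \<subseteq> leaf_cells (Node l it r) X" unfolding it by (simp add: eq)
    ultimately show ?thesis by blast
  next
    case 3
    then have pos: "card ?A \<ge> 1" "card ?B \<ge> 1"
      using fin by (simp_all add: Suc_le_eq card_gt_0_iff)
    have size: "size1 l \<ge> 1" "size1 r \<ge> 1" by (simp_all add: size1_size)
    \<comment> \<open>The right side reserves the groups that its hypothesis demands, and the left
      side takes what it can hold of the remainder.\<close>
    define n1 where "n1 = min (card ?A) (n - min (size1 r) (card ?B))"
    have n: "1 \<le> n1" "n1 \<le> card ?A" "min (size1 l) (card ?A) \<le> n1" "1 \<le> n - n1"
      "n - n1 \<le> card ?B" "min (size1 r) (card ?B) \<le> n - n1" "n = n1 + (n - n1)"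
      using pos card size Node.prems(3,4,6) unfolding n1_def size1.simps by linarith+
    obtain l' where l': "tree_partition d n1 ?A l'"
      "\<forall>C\<in>leaf_cells l' ?A. \<exists>D\<in>leaf_cells l ?A. C \<subseteq> D"
      using Node.IH(1)[OF fin(1) sub(1) n(1,2) valid(1) n(3)] by blast
    obtain r' where r': "tree_partition d (n - n1) ?B r'"
      "\<forall>C\<in>leaf_cells r' ?B. \<exists>D\<in>leaf_cells r ?B. C \<subseteq> D"
      using Node.IH(2)[OF fin(2) sub(2) n(4,5) valid(2) n(6)] by blast
    have "tree_partition d n X (Node l' (i, \<theta>) r')"
      using tree_partition_Node[OF Node.prems(1) valid(3) l'(1) r'(1)] n(7) by simp
    moreover have "\<exists>D\<in>leaf_cells (Node l it r) X. C \<subseteq> D"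
      if C: "C \<in> leaf_cells (Node l' (i, \<theta>) r') X" for C
    proof -
      consider "C \<in> leaf_cells l' ?A" | "C \<in> leaf_cells r' ?B" using C by auto
      then show ?thesis
      proof cases
        case 1
        then obtain D where "D \<in> leaf_cells l ?A" "C \<subseteq> D" using l'(2) by blast
        then show ?thesis unfolding it by auto
      next
        case 2
        then obtain D where "D \<in> leaf_cells r ?B" "C \<subseteq> D" using r'(2) by blast
        then show ?thesis unfolding it by auto
      qed
    qed
    ultimately show ?thesis by blast
  qed
qed

section \<open>Comparison of the optimal costs\<close>

lemma cost_nonneg: "cost d P \<mu> \<ge> 0"
  unfolding cost_def by (intro sum_nonneg) auto

lemma sum_over_partition:
  assumes "finite X" "partition_on X P"
  shows "(\<Sum>C\<in>P. \<Sum>x\<in>C. f x) = (\<Sum>x\<in>X. f x)"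
proof -
  have "\<forall>C\<in>P. finite C"
    using assms(1) unfolding partition_onD1[OF assms(2)] by (blast intro: finite_subset)
  moreover have "\<forall>A\<in>P. \<forall>B\<in>P. A \<noteq> B \<longrightarrow> A \<inter> B = {}"
    using partition_onD2[OF assms(2)] by (auto simp: disjoint_def)
  ultimately show ?thesis
    unfolding partition_onD1[OF assms(2)] by (simp add: sum.Union_disjoint)
qed

text \<open>The tree for the centers is refined to \<open>k\<close> nonempty cells. Each new cell
  lies in an old one, where \<open>rep\<close> is constant, so the cost of the new clustering is the
  sum bounded for the tree.\<close>

lemma OPT_exp_le_cost:
  assumes inst: "kmeans_instance k d X" and "k \<ge> 1" and clus: "clustering k d X P \<mu>"
  shows "OPT_exp k d X \<le> (2 + 16 * harm k * real d * real k) * cost d P \<mu>"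
proof -
  have X: "finite X" "X \<subseteq> Rn d" "k \<le> card X" using inst unfolding kmeans_instance_def by auto
  have P: "partition_on X P" "card P = k" "\<mu> ` P \<subseteq> Rn d"
    using clus unfolding clustering_def by auto
  have finP: "finite P" using P(1) X(1) by (rule finite_elements[rotated])
  define part where "part x = (THE C. C \<in> P \<and> x \<in> C)" for x
  have part: "part x = C" if "C \<in> P" "x \<in> C" for x C
    unfolding part_def
  proof (rule the_equality)
    fix D assume "D \<in> P \<and> x \<in> D"
    then show "D = C" using that disjointD[OF partition_onD2[OF P(1)]] by blast
  qed (use that in simp)
  \<comment> \<open>Representatives of different groups may coincide, so \<open>S\<close> can have
    fewer than \<open>k\<close> elements; the refinement makes up for the missing leaves.\<close>
  define S where "S = \<mu> ` P"
  have "P \<noteq> {}" using P(2) \<open>k \<ge> 1\<close> by auto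
  then have S: "finite S" "S \<noteq> {}" "S \<subseteq> Rn d" "card S \<le> k"
    using finP P(2,3) card_image_le[OF finP, of \<mu>] unfolding S_def by simp_all
  have "\<mu> (part x) \<in> S" if "x \<in> X" for x
  proof -
    obtain C where "C \<in> P" "x \<in> C" using \<open>x \<in> X\<close> partition_onD1[OF P(1)] by blast
    then show ?thesis using part[of C x] unfolding S_def by simp
  qed
  then have "(\<lambda>x. \<mu> (part x)) ` X \<subseteq> S" by blast
  then obtain T rep where T: "valid_tree d T" "size1 T = card S" "range rep \<subseteq> S"
    "\<forall>Z. \<forall>C\<in>leaf_cells T Z. \<forall>x\<in>C. \<forall>y\<in>C. rep x = rep y"
    and bound: "(\<Sum>x\<in>X. (dist2 d x (rep x))\<^sup>2)
      \<le> (2 + 16 * harm k * real d * real (card S)) * (\<Sum>x\<in>X. (dist2 d x (\<mu> (part x)))\<^sup>2)"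
    using tree_for_centers[OF S X(1), of "\<lambda>x. \<mu> (part x)"] by blast
  have "min (size1 T) (card X) \<le> k" using T(2) S(4) by simp
  then obtain T' where T': "tree_partition d k X T'"
    "\<forall>C\<in>leaf_cells T' X. \<exists>D\<in>leaf_cells T X. C \<subseteq> D"
    using tree_partition_refines[OF X(1,2) \<open>k \<ge> 1\<close> X(3) T(1)] by blast
  define P' where "P' = leaf_cells T' X"
  define \<mu>' where "\<mu>' C = rep (SOME x. x \<in> C)" for C
  have P': "partition_on X P'" "card P' = k" "explainable k d X P'"
    using T'(1) unfolding tree_partition_def explainable_def P'_def by blast+
  have "\<mu>' C \<in> Rn d" for C using T(3) S(3) unfolding \<mu>'_def by blast
  then have "clustering k d X P' \<mu>'" using P'(1,2) unfolding clustering_def by blast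
  then have "cost d P' \<mu>' \<in> {cost d P \<mu> | P \<mu>. clustering k d X P \<mu> \<and> explainable k d X P}"
    using P'(3) by blast
  moreover have "bdd_below {cost d P \<mu> | P \<mu>. clustering k d X P \<mu> \<and> explainable k d X P}"
    by (rule bdd_belowI[of _ 0]) (auto intro: cost_nonneg)
  ultimately have "OPT_exp k d X \<le> cost d P' \<mu>'"
    unfolding OPT_exp_def by (rule cInf_lower)
  also have "cost d P' \<mu>' = (\<Sum>C\<in>P'. \<Sum>x\<in>C. (dist2 d x (rep x))\<^sup>2)"
  proof -
    have rep_const: "\<mu>' C = rep x" if C: "C \<in> P'" "x \<in> C" for C x
    proof -
      obtain D where "D \<in> leaf_cells T X" "C \<subseteq> D" using T'(2) C(1) unfolding P'_def by blast
      moreover have "(SOME x. x \<in> C) \<in> C" using someI[of "\<lambda>x. x \<in> C", OF C(2)] .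
      ultimately show ?thesis using T(4) C(2) unfolding \<mu>'_def by (meson subsetD)
    qed
    show ?thesis
      unfolding cost_def
    proof (intro sum.cong refl)
      fix C x assume "C \<in> P'" "x \<in> C"
      then have "\<mu>' C = rep x" by (rule rep_const)
      then show "(dist2 d x (\<mu>' C))\<^sup>2 = (dist2 d x (rep x))\<^sup>2" by simp
    qed
  qed
  also have "\<dots> = (\<Sum>x\<in>X. (dist2 d x (rep x))\<^sup>2)"
    using X(1) P'(1) by (rule sum_over_partition)
  also note bound
  also have "(\<Sum>x\<in>X. (dist2 d x (\<mu> (part x)))\<^sup>2)
      = (\<Sum>C\<in>P. \<Sum>x\<in>C. (dist2 d x (\<mu> (part x)))\<^sup>2)"
    by (rule sum_over_partition[OF X(1) P(1), symmetric])
  also have "\<dots> = cost d P \<mu>" unfolding cost_def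
  proof (intro sum.cong refl)
    fix C x assume "C \<in> P" "x \<in> C"
    then have "part x = C" by (rule part)
    then show "(dist2 d x (\<mu> (part x)))\<^sup>2 = (dist2 d x (\<mu> C))\<^sup>2" by simp
  qed
  also have "(2 + 16 * harm k * real d * real (card S)) * cost d P \<mu>
      \<le> (2 + 16 * harm k * real d * real k) * cost d P \<mu>"
    using S(4) harm_nonneg[of k, where ?'a = real]
    by (intro mult_right_mono add_left_mono mult_left_mono cost_nonneg) auto
  finally show ?thesis .
qed

lemma OPT_exp_le_OPT_unr:
  assumes inst: "kmeans_instance k d X" and "k \<ge> 1"
  shows "OPT_exp k d X \<le> (2 + 16 * harm k * real d * real k) * OPT_unr k d X"
proof -
  define B :: real where "B = 2 + 16 * harm k * real d * real k"
  have "B > 0" unfolding B_def using harm_nonneg[of k, where ?'a = real] by (simp add: add_pos_nonneg)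
  have X: "finite X" "X \<subseteq> Rn d" "k \<le> card X" using inst unfolding kmeans_instance_def by auto
  \<comment> \<open>Any clustering will do: it shows that the infimum is over a nonempty
    set.\<close>
  obtain T where "tree_partition d k X T" using tree_partition_exists[OF X(1,2) \<open>k \<ge> 1\<close> X(3)] by blast
  then have "clustering k d X (leaf_cells T X) (\<lambda>_. restrict (\<lambda>_. 0) {1..d})"
    unfolding clustering_def tree_partition_def Rn_def by auto
  then have ne: "{cost d P \<mu> | P \<mu>. clustering k d X P \<mu>} \<noteq> {}" by blast
  have "OPT_exp k d X / B \<le> OPT_unr k d X"
    unfolding OPT_unr_def
  proof (rule cInf_greatest[OF ne])
    fix y assume "y \<in> {cost d P \<mu> | P \<mu>. clustering k d X P \<mu>}"
    then show "OPT_exp k d X / B \<le> y"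
      using OPT_exp_le_cost[OF assms] \<open>B > 0\<close> unfolding B_def by (auto simp: field_simps)
  qed
  then show ?thesis using \<open>B > 0\<close> unfolding B_def by (simp add: field_simps)
qed

theorem theorem4:
  shows "\<exists>C::real. C > 0 \<and>
    (\<forall>k d::nat. k \<ge> 2 \<longrightarrow> d \<ge> 1 \<longrightarrow>
      price_of_explainability k d \<le> ereal (C * real d * real k * ln (real k)))"
proof (intro exI conjI allI impI)
  \<comment> \<open>50 = 16 * 3 + 2: \<open>harm k \<le> 3 * ln k\<close> gives 48, and the summand
    2 is absorbed by \<open>d * k * ln k \<ge> 1\<close>.\<close>
  show "(50::real) > 0" by simp
  fix k d :: nat assume k: "k \<ge> 2" and d: "d \<ge> 1"
  \<comment> \<open>Here \<open>k \<ge> 2\<close> enters: the 1 in \<open>1 + ln k\<close> is at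
    most \<open>2 * ln k\<close>.\<close>
  have "ln 2 \<ge> (1/2::real)" using ln_2_less_1 ln2_ge_two_thirds by linarith
  moreover have "ln (real k) \<ge> ln 2" using k by simp
  ultimately have ln_k: "1 \<le> 2 * ln (real k)" by linarith
  then have "harm k \<le> 3 * ln (real k)" using harm_le_one_plus_ln[of k] k by simp
  then have "16 * harm k * real d * real k \<le> 16 * (3 * ln (real k)) * real d * real k"
    by (intro mult_right_mono mult_left_mono) auto
  moreover have "1 * 1 \<le> real d * (real k * ln (real k))"
  proof (intro mult_mono)
    have "1 \<le> 2 * ln (real k)" by (rule ln_k)
    also have "\<dots> \<le> real k * ln (real k)" using k ln_k by (intro mult_right_mono) auto
    finally show "1 \<le> real k * ln (real k)" .
  qed (use d in auto)
  ultimately have factor: "2 + 16 * harm k * real d * real k \<le> 50 * real d * real k * ln (real k)"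
    by (simp add: mult_ac)
  show "price_of_explainability k d \<le> ereal (50 * real d * real k * ln (real k))"
    unfolding price_of_explainability_def
  proof (rule SUP_least)
    fix X assume "X \<in> {X. kmeans_instance k d X \<and> OPT_unr k d X > 0}"
    then have X: "kmeans_instance k d X" "OPT_unr k d X > 0" by auto
    then have "OPT_exp k d X / OPT_unr k d X \<le> 2 + 16 * harm k * real d * real k"
      using OPT_exp_le_OPT_unr[OF X(1)] k by (simp add: divide_le_eq)
    then show "ereal (OPT_exp k d X / OPT_unr k d X) \<le> ereal (50 * real d * real k * ln (real k))"
      using factor by simp
  qed
qed

end
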